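(* Let $G=(V,E)$ be either an adjacency graph, or a finite connected graph. Let $f\colon V\to\mathbb{R}$ be a function, assumed to be continuous if $G$ is an adjacency graph. Then the equation $$u(x)-\frac12\Big(\min_{y\sim x}u(y)+\max_{y\sim x}u(y)\Big)=f(x)\qquad\text{for all }x\in V$$ has a solution $u\colon V\to\mathbb{R}$ if and only if $c_f=0$.
   Context: A compact length space is a compact metric space $(V,d)$ such that for all $x,y\in V$ the distance $d(x,y)$ is the infimum of the lengths of rectifiable paths between $x$ and $y$. For $\epsilon>0$, the $\epsilon$-adjacency graph of $(V,d)$ has vertex set $V$, and two vertices $x,y$ are connected if and only if $d(x,y)\le\epsilon$ (so every vertex has a loop). An adjacency graph is an $\epsilon$-adjacency graph of some compact length space for some $\epsilon>0$. We write $x\sim y$ if $x,y$ are joined by an edge; every vertex is assumed to have at least one neighbor (possibly itself, through a loop). For $u$ to be a solution, the minima and maxima in the equation must exist. Game values: the sequence of game values with terminal payoff $u_0$ and running payoff $f$ is the sequence $(u_n)_{n\ge0}$ starting from $u_0$ with $$u_{n+1}(x)=\frac12\Big(\inf_{y\sim x}u_n(y)+\sup_{y\sim x}u_n(y)\Big)+f(x),\qquad x\in V,\ n\ge0.$$ Player I's long term advantage: for a bounded function $f$, $c_f$ is the (unique) real constant such that for every bounded $u_0\colon V\to\mathbb{R}$ the sequence of functions $(u_n-nc_f)$ is uniformly bounded, where $(u_n)$ are the game values with terminal payoff $u_0$ and running payoff $f$ (such a constant exists on every connected graph of finite diameter). *)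

theory Defs
  imports "HOL-Analysis.Analysis"
begin

text \<open>
  Undirected graphs are symmetric relations on a vertex set; loops are allowed. The vertex set is
  nonempty: on the empty graph every constant would be a long term advantage.
\<close>

definition undirected_graph :: "'a set \<Rightarrow> 'a rel \<Rightarrow> bool" where
  "undirected_graph V E \<longleftrightarrow>
     V \<noteq> {} \<and> E \<subseteq> V \<times> V \<and> sym E \<and> (\<forall>x\<in>V. \<exists>y. (x, y) \<in> E)"

definition connected_graph :: "'a set \<Rightarrow> 'a rel \<Rightarrow> bool" where
  "connected_graph V E \<longleftrightarrow> undirected_graph V E \<and> (\<forall>x\<in>V. \<forall>y\<in>V. (x, y) \<in> E\<^sup>*)"

definition mpath_length :: "'a metric \<Rightarrow> (real \<Rightarrow> 'a) \<Rightarrow> ereal" where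
  "mpath_length m g =
     (SUP n. SUP t\<in>{t :: nat \<Rightarrow> real. mono t \<and> range t \<subseteq> {0..1}}.
        ereal (\<Sum>i<n. mdist m (g (t i)) (g (t (Suc i)))))"

definition rectifiable_paths :: "'a metric \<Rightarrow> 'a \<Rightarrow> 'a \<Rightarrow> (real \<Rightarrow> 'a) set" where
  "rectifiable_paths m x y =
     {g. pathin (mtopology_of m) g \<and> g 0 = x \<and> g 1 = y \<and> mpath_length m g < \<infinity>}"

text \<open>
  The infimum is taken in \<^typ>\<open>ereal\<close>, so it is infinite when there is no rectifiable path;
  hence any two points of a length space are joined by one.
\<close>

definition compact_length_space :: "'a metric \<Rightarrow> bool" where
  "compact_length_space m \<longleftrightarrow>
     compact_space (mtopology_of m) \<and>
     (\<forall>x\<in>mspace m. \<forall>y\<in>mspace m.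
        ereal (mdist m x y) = (INF g\<in>rectifiable_paths m x y. mpath_length m g))"

definition adjacency_edges :: "'a metric \<Rightarrow> real \<Rightarrow> 'a rel" where
  "adjacency_edges m \<epsilon> = {(x, y). x \<in> mspace m \<and> y \<in> mspace m \<and> mdist m x y \<le> \<epsilon>}"

definition is_adjacency_graph :: "'a metric \<Rightarrow> real \<Rightarrow> 'a set \<Rightarrow> 'a rel \<Rightarrow> bool" where
  "is_adjacency_graph m \<epsilon> V E \<longleftrightarrow>
     compact_length_space m \<and> \<epsilon> > 0 \<and> V = mspace m \<and> E = adjacency_edges m \<epsilon>"

text \<open>
  The real-valued \<^const>\<open>Inf\<close> and \<^const>\<open>Sup\<close> are meaningful only on bounded sets; game values
  are used below only for bounded \<open>u0\<close> and bounded \<open>f\<close>, where every \<open>u\<^sub>n\<close> is bounded on the vertices.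
\<close>

primrec game_value :: "'a rel \<Rightarrow> ('a \<Rightarrow> real) \<Rightarrow> ('a \<Rightarrow> real) \<Rightarrow> nat \<Rightarrow> 'a \<Rightarrow> real" where
  "game_value E f u0 0 = u0"
| "game_value E f u0 (Suc n) =
     (\<lambda>x. ((INF y\<in>E `` {x}. game_value E f u0 n y) + (SUP y\<in>E `` {x}. game_value E f u0 n y)) / 2
           + f x)"

definition long_term_advantage :: "'a set \<Rightarrow> 'a rel \<Rightarrow> ('a \<Rightarrow> real) \<Rightarrow> real" where
  "long_term_advantage V E f =
     (THE c. \<forall>u0. bounded (u0 ` V) \<longrightarrow>
        (\<exists>B. \<forall>n. \<forall>x\<in>V. \<bar>game_value E f u0 n x - real n * c\<bar> \<le> B))"

text \<open>Being a solution includes that the minimum and the maximum over the neighbours are attained.\<close>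

definition is_solution :: "'a set \<Rightarrow> 'a rel \<Rightarrow> ('a \<Rightarrow> real) \<Rightarrow> ('a \<Rightarrow> real) \<Rightarrow> bool" where
  "is_solution V E f u \<longleftrightarrow>
     (\<forall>x\<in>V. \<exists>y z. is_arg_min u (\<lambda>w. (x, w) \<in> E) y \<and> is_arg_max u (\<lambda>w. (x, w) \<in> E) z \<and>
        u x - (u y + u z) / 2 = f x)"

end

theory Submission
  imports Defs
begin

text \<open>
  Write \<open>T u x\<close> for half the sum of the infimum and the supremum of \<open>u\<close> over the neighbours of \<open>x\<close>,
  plus \<open>f x\<close>. This operator is monotone, commutes with adding constants, and hence is nonexpansive
  for the supremum norm, so a solution is a bounded orbit and forces \<open>c\<^sub>f = 0\<close>. On a connected graph of
  finite diameter the oscillation of \<open>T\<^sup>n 0\<close> is bounded in \<open>n\<close>; hence \<open>T\<^sup>n 0\<close> at a fixed vertex is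
  additive in \<open>n\<close> up to a bounded error, which shows that \<open>c\<^sub>f\<close> exists.

  If \<open>c\<^sub>f = 0\<close>, then \<open>T\<^sup>n 0\<close> is bounded. Its half-relaxed upper limit \<open>limsup T\<^sup>n 0 (y)\<close> for \<open>n \<rightarrow> \<infinity>\<close> and
  \<open>y \<rightarrow> x\<close> is a bounded \<open>v\<close> with \<open>v \<le> T v\<close>, and the lower one is a bounded \<open>w\<close> with \<open>T w \<le> w\<close>. After
  adding a constant to \<open>w\<close> we may assume \<open>v \<le> w\<close>, so \<open>T\<close> has a bounded fixed point, possibly with
  infima and suprema that are not attained. On an adjacency graph, however, every bounded fixed point
  turns out to be uniformly continuous, so it is a solution. Finite graphs are covered by the same
  argument with the discrete metric.
\<close>

section \<open>The averaging operator and the defining property of the advantage\<close>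

definition tug_step :: "'a rel \<Rightarrow> ('a \<Rightarrow> real) \<Rightarrow> ('a \<Rightarrow> real) \<Rightarrow> 'a \<Rightarrow> real" where
  "tug_step E f u x = ((INF y\<in>E `` {x}. u y) + (SUP y\<in>E `` {x}. u y)) / 2 + f x"

lemma game_value_Suc: "game_value E f u (Suc n) = tug_step E f (game_value E f u n)"
  by (simp add: fun_eq_iff tug_step_def)

lemma game_value_add:
  "game_value E f u (m + n) = game_value E f (game_value E f u m) n"
  by (induction n) auto

text \<open>The predicate under \<open>THE\<close> in \<open>long_term_advantage\<close>. That
  description determines a value only once existence and uniqueness are known, and both are proved
  for this predicate.\<close>

definition bounded_advantage :: "'a set \<Rightarrow> 'a rel \<Rightarrow> ('a \<Rightarrow> real) \<Rightarrow> real \<Rightarrow> bool" where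
  "bounded_advantage V E f c \<longleftrightarrow> (\<forall>u0. bounded (u0 ` V) \<longrightarrow>
        (\<exists>B. \<forall>n. \<forall>x\<in>V. \<bar>game_value E f u0 n x - real n * c\<bar> \<le> B))"

lemma bounded_image_real: "bounded (u ` V) \<longleftrightarrow> (\<exists>B::real. \<forall>x\<in>V. \<bar>u x\<bar> \<le> B)"
  by (auto simp: bounded_iff)

text \<open>Boundedness does not enter: on the reals \<open>Inf\<close> is defined as minus the
  \<open>Sup\<close> of the negated set.\<close>

lemma cINF_uminus: "(INF y\<in>A. - u y) = - (SUP y\<in>A. u y)" for u :: "'a \<Rightarrow> real"
  by (simp add: Inf_real_def image_image)

lemma cSUP_uminus: "(SUP y\<in>A. - u y) = - (INF y\<in>A. u y)" for u :: "'a \<Rightarrow> real"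
  by (simp add: Inf_real_def image_image)

text \<open>Negation exchanges the two players, so subsolutions for \<open>- f\<close> become
  supersolutions for \<open>f\<close>.\<close>

lemma tug_step_uminus: "tug_step E (\<lambda>x. - f x) (\<lambda>x. - u x) x = - tug_step E f u x"
  unfolding tug_step_def cINF_uminus cSUP_uminus by argo

text \<open>A Fekete argument: \<open>t + C\<close> is subadditive and \<open>t - C\<close> is
  superadditive, so every quotient \<open>(t n - C) / n\<close> lies below every
  \<open>(t m + C) / m\<close>. Any \<open>c\<close> separating the two families works; the supremum
  of the lower one is taken.\<close>

lemma quasi_additive_imp_linear:
  fixes t :: "nat \<Rightarrow> real"
  assumes q: "\<And>m n. \<bar>t (m + n) - t m - t n\<bar> \<le> C"
  obtains c where "\<And>n. \<bar>t n - real n * c\<bar> \<le> C"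
proof -
  have t0: "\<bar>t 0\<bar> \<le> C" using q[of 0 0] by simp
  \<comment> \<open>The case \<open>k = 0\<close> is excluded because the left side would be
    \<open>t 0 + C\<close>, which may be positive.\<close>
  have up: "t (k * n) + C \<le> k * (t n + C)" if "k > 0" for k n
    using that
  proof (induction k)
    case (Suc k)
    show ?case
    proof (cases "k = 0")
      case False
      then show ?thesis using Suc.IH q[of n "k * n"] by (simp add: algebra_simps)
    qed simp
  qed simp
  have low: "t (k * n) - C \<ge> k * (t n - C)" if "k > 0" for k n
    using that
  proof (induction k)
    case (Suc k)
    show ?case
    proof (cases "k = 0")
      case False
      then show ?thesis using Suc.IH q[of n "k * n"] by (simp add: algebra_simps)
    qed simp
  qed simp
  \<comment> \<open>Both quotients are compared at the common multiple \<open>m * n\<close>;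
    \<open>t0\<close> supplies \<open>C \<ge> 0\<close>.\<close>
  have cross: "(t n - C) / n \<le> (t m + C) / m" if "n > 0" "m > 0" for n m :: nat
  proof -
    have "m * (t n - C) \<le> n * (t m + C)"
      using low[OF that(2), of n] up[OF that(1), of m] t0 by (simp add: mult.commute)
    then show ?thesis using that by (simp add: field_simps)
  qed
  define c where "c = (SUP n\<in>{0<..}. (t n - C) / real n)"
  have bd: "bdd_above ((\<lambda>n. (t n - C) / real n) ` {0<..})"
    by (rule bdd_aboveI[of _ "(t 1 + C) / real 1"]) (use cross[of _ 1] in auto)
  have "\<bar>t n - real n * c\<bar> \<le> C" for n
  proof (cases "n = 0")
    case False
    then have "(t n - C) / n \<le> c" unfolding c_def by (intro cSUP_upper bd) auto
    moreover have "c \<le> (t n + C) / n" unfolding c_def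
      by (rule cSUP_least) (use cross False in auto)
    ultimately show ?thesis using False by (simp add: field_simps abs_le_iff)
  qed (use t0 in simp)
  then show thesis by (rule that)
qed

section \<open>Order properties of the operator on bounded functions\<close>

locale payoff_graph =
  fixes V :: "'a set" and E :: "'a rel" and f :: "'a \<Rightarrow> real"
  assumes graph: "undirected_graph V E"
    and bounded_payoff: "bounded (f ` V)"
begin

lemma nbr_sub: "E `` {x} \<subseteq> V"
  using graph by (auto simp: undirected_graph_def)

lemma nbr_nonempty: "x \<in> V \<Longrightarrow> E `` {x} \<noteq> {}"
  using graph by (auto simp: undirected_graph_def)

lemma bdd_nbr:
  fixes u :: "'a \<Rightarrow> real"
  assumes "bounded (u ` V)"
  shows "bdd_above (u ` (E `` {x}))" "bdd_below (u ` (E `` {x}))"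
  using bounded_subset[OF assms image_mono[OF nbr_sub], of x]
  by (simp_all add: bounded_imp_bdd_above bounded_imp_bdd_below)

text \<open>The shift \<open>k\<close> may have either sign. Carrying it along makes
  nonexpansiveness and the commutation with constants consequences of this one estimate.\<close>

lemma tug_step_mono:
  assumes "bounded (u ` V)" "bounded (v ` V)" and le: "\<And>y. y \<in> V \<Longrightarrow> u y \<le> v y + k" and x: "x \<in> V"
  shows "tug_step E f u x \<le> tug_step E f v x + k"
proof -
  note bu = bdd_nbr[OF assms(1), of x] and bv = bdd_nbr[OF assms(2), of x] and ne = nbr_nonempty[OF x]
  have "(SUP y\<in>E `` {x}. u y) \<le> (SUP y\<in>E `` {x}. v y) + k"
  proof (rule cSUP_least[OF ne])
    fix y assume y: "y \<in> E `` {x}"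
    have "v y \<le> (SUP y\<in>E `` {x}. v y)" by (rule cSUP_upper[OF y bv(1)])
    then show "u y \<le> (SUP y\<in>E `` {x}. v y) + k" using le[of y] y nbr_sub[of x] by force
  qed
  moreover have "(INF y\<in>E `` {x}. u y) - k \<le> (INF y\<in>E `` {x}. v y)"
  proof (rule cINF_greatest[OF ne])
    fix y assume y: "y \<in> E `` {x}"
    have "(INF y\<in>E `` {x}. u y) \<le> u y" by (rule cINF_lower[OF bu(2) y])
    then show "(INF y\<in>E `` {x}. u y) - k \<le> v y" using le[of y] y nbr_sub[of x] by force
  qed
  ultimately show ?thesis unfolding tug_step_def by argo
qed

lemma bounded_tug_step:
  assumes "bounded (u ` V)"
  shows "bounded (tug_step E f u ` V)"
proof -
  obtain B where B: "\<And>x. x \<in> V \<Longrightarrow> \<bar>u x\<bar> \<le> B" using assms by (auto simp: bounded_image_real)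
  obtain F where F: "\<And>x. x \<in> V \<Longrightarrow> \<bar>f x\<bar> \<le> F" using bounded_payoff by (auto simp: bounded_image_real)
  have "\<bar>tug_step E f u x\<bar> \<le> B + F" if x: "x \<in> V" for x
  proof -
    note bu = bdd_nbr[OF assms(1), of x] and ne = nbr_nonempty[OF x]
    \<comment> \<open>A single neighbour places the infimum below the supremum, so the two one-sided
      bounds that follow control both.\<close>
    obtain y where y: "y \<in> E `` {x}" using ne by blast
    have nb: "\<bar>u z\<bar> \<le> B" if "z \<in> E `` {x}" for z using that nbr_sub[of x] B by blast
    have "(SUP y\<in>E `` {x}. u y) \<le> B"
      by (rule cSUP_least[OF ne]) (use nb in \<open>simp add: abs_le_iff\<close>)
    moreover have "- B \<le> (INF y\<in>E `` {x}. u y)"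
      by (rule cINF_greatest[OF ne]) (use nb in \<open>force simp add: abs_le_iff\<close>)
    ultimately show ?thesis
      using cSUP_upper[OF y bu(1)] cINF_lower[OF bu(2) y] F[OF x] unfolding tug_step_def abs_le_iff by argo
  qed
  then show ?thesis by (auto simp: bounded_image_real)
qed

lemma bounded_game_value: "bounded (u ` V) \<Longrightarrow> bounded (game_value E f u n ` V)"
proof (induction n)
  case (Suc n)
  then show ?case unfolding game_value_Suc by (intro bounded_tug_step) auto
qed simp

lemma game_value_mono:
  assumes "bounded (u ` V)" "bounded (v ` V)" "\<And>y. y \<in> V \<Longrightarrow> u y \<le> v y + k" "x \<in> V"
  shows "game_value E f u n x \<le> game_value E f v n x + k"
  using assms(4)
proof (induction n arbitrary: x)
  case (Suc n)
  then show ?case unfolding game_value_Suc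
    by (intro tug_step_mono bounded_game_value assms) auto
qed (use assms in auto)

lemma game_value_nonexpansive:
  assumes "bounded (u ` V)" "bounded (v ` V)" "\<And>y. y \<in> V \<Longrightarrow> \<bar>u y - v y\<bar> \<le> k" "x \<in> V"
  shows "\<bar>game_value E f u n x - game_value E f v n x\<bar> \<le> k"
proof -
  have "game_value E f u n x \<le> game_value E f v n x + k"
    by (rule game_value_mono) (use assms in \<open>auto simp: abs_le_iff algebra_simps\<close>)
  moreover have "game_value E f v n x \<le> game_value E f u n x + k"
    by (rule game_value_mono) (use assms in \<open>auto simp: abs_le_iff algebra_simps\<close>)
  ultimately show ?thesis by linarith
qed

lemma game_value_add_const:
  assumes "bounded (u ` V)" "x \<in> V"
  shows "game_value E f (\<lambda>y. u y + k) n x = game_value E f u n x + k"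
proof -
  have b: "bounded ((\<lambda>y. u y + k) ` V)"
    using bounded_plus_comp[OF assms(1), of "\<lambda>_. k"] by (auto simp: image_constant_conv)
  have "game_value E f (\<lambda>y. u y + k) n x \<le> game_value E f u n x + k"
    by (rule game_value_mono) (use assms b in auto)
  moreover have "game_value E f u n x \<le> game_value E f (\<lambda>y. u y + k) n x + - k"
    by (rule game_value_mono) (use assms b in auto)
  ultimately show ?thesis by linarith
qed

section \<open>Uniqueness of the advantage and its value when there is a fixed point\<close>

lemma bounded_advantage_unique:
  assumes "bounded_advantage V E f c" "bounded_advantage V E f c'"
  shows "c = c'"
proof (rule ccontr)
  assume ne: "c \<noteq> c'"
  have b0: "bounded ((\<lambda>_. 0::real) ` V)" by (auto simp: image_constant_conv)
  obtain x where x: "x \<in> V" using graph by (auto simp: undirected_graph_def)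
  obtain B where B: "\<And>n. \<bar>game_value E f (\<lambda>_. 0) n x - real n * c\<bar> \<le> B"
    using assms(1) b0 x unfolding bounded_advantage_def by blast
  obtain B' where B': "\<And>n. \<bar>game_value E f (\<lambda>_. 0) n x - real n * c'\<bar> \<le> B'"
    using assms(2) b0 x unfolding bounded_advantage_def by blast
  obtain n where n: "real n * \<bar>c - c'\<bar> > B + B'"
    using reals_Archimedean3[of "\<bar>c - c'\<bar>"] ne by auto
  have "real n * \<bar>c - c'\<bar> = \<bar>real n * c - real n * c'\<bar>"
    by (simp add: abs_mult flip: right_diff_distrib)
  then show False using n B[of n] B'[of n] by linarith
qed

lemma long_term_advantage_eq:
  assumes "bounded_advantage V E f c"
  shows "long_term_advantage V E f = c"
  unfolding long_term_advantage_def bounded_advantage_def[symmetric]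
  by (rule the_equality) (use assms bounded_advantage_unique in auto)

text \<open>A fixed point reproduces itself as game value, and nonexpansiveness keeps the game
  values from any other bounded \<open>u0\<close> within a fixed distance of it.\<close>

lemma fixed_point_imp_bounded_advantage:
  assumes u: "bounded (u ` V)" and fp: "\<And>x. x \<in> V \<Longrightarrow> tug_step E f u x = u x"
  shows "bounded_advantage V E f 0"
  unfolding bounded_advantage_def
proof (intro allI impI)
  fix u0 :: "'a \<Rightarrow> real" assume u0: "bounded (u0 ` V)"
  have gv: "game_value E f u n x = u x" if "x \<in> V" for n x
    using that
  proof (induction n arbitrary: x)
    case (Suc n)
    have eq: "(\<lambda>y. game_value E f u n y) ` (E `` {x}) = u ` (E `` {x})"
      using Suc.IH nbr_sub[of x] by (intro image_cong) auto
    have "game_value E f u (Suc n) x = tug_step E f u x"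
      unfolding game_value_Suc tug_step_def using eq by simp
    then show ?case using fp Suc by simp
  qed simp
  obtain B where B: "\<And>x. x \<in> V \<Longrightarrow> \<bar>u x\<bar> \<le> B" using u by (auto simp: bounded_image_real)
  obtain B0 where B0: "\<And>x. x \<in> V \<Longrightarrow> \<bar>u0 x\<bar> \<le> B0" using u0 by (auto simp: bounded_image_real)
  have "\<bar>game_value E f u0 n x - real n * 0\<bar> \<le> B0 + 2 * B" if x: "x \<in> V" for n x
  proof -
    have "\<bar>game_value E f u0 n x - game_value E f u n x\<bar> \<le> B0 + B"
      by (rule game_value_nonexpansive[OF u0 u _ x]) (use B B0 in \<open>smt (verit)\<close>)
    then show ?thesis using gv[OF x, of n] B[OF x] by simp
  qed
  then show "\<exists>B. \<forall>n. \<forall>x\<in>V. \<bar>game_value E f u0 n x - real n * 0\<bar> \<le> B" by blast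
qed

text \<open>The Knaster--Tarski argument, carried out in the functions between \<open>v\<close> and \<open>w\<close>.\<close>

lemma fixed_point_between:
  assumes v: "bounded (v ` V)" and w: "bounded (w ` V)"
    and vw: "\<And>x. x \<in> V \<Longrightarrow> v x \<le> w x"
    and sub: "\<And>x. x \<in> V \<Longrightarrow> v x \<le> tug_step E f v x"
    and super: "\<And>x. x \<in> V \<Longrightarrow> tug_step E f w x \<le> w x"
  obtains u where "bounded (u ` V)" "\<And>x. x \<in> V \<Longrightarrow> tug_step E f u x = u x"
proof -
  define S where "S = {g. \<forall>x\<in>V. v x \<le> g x \<and> g x \<le> w x \<and> g x \<le> tug_step E f g x}"
  define u where "u = (\<lambda>x. SUP g\<in>S. g x)"
  obtain Bv where Bv: "\<And>x. x \<in> V \<Longrightarrow> \<bar>v x\<bar> \<le> Bv" using v by (auto simp: bounded_image_real)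
  obtain Bw where Bw: "\<And>x. x \<in> V \<Longrightarrow> \<bar>w x\<bar> \<le> Bw" using w by (auto simp: bounded_image_real)
  have between: "bounded (g ` V)" if "\<And>x. x \<in> V \<Longrightarrow> v x \<le> g x \<and> g x \<le> w x" for g
  proof -
    have "\<bar>g x\<bar> \<le> Bv + Bw" if "x \<in> V" for x
      using \<open>\<And>x. x \<in> V \<Longrightarrow> v x \<le> g x \<and> g x \<le> w x\<close>[OF that] Bv[OF that] Bw[OF that] by linarith
    then show ?thesis by (auto simp: bounded_image_real)
  qed
  have vS: "v \<in> S" using vw sub by (auto simp: S_def)
  have upper: "g x \<le> u x" if "g \<in> S" "x \<in> V" for g x
    unfolding u_def
  proof (rule cSUP_upper[OF that(1)])
    show "bdd_above ((\<lambda>g. g x) ` S)" using that(2) by (intro bdd_aboveI[of _ "w x"]) (auto simp: S_def)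
  qed
  have least: "u x \<le> a" if "\<And>g. g \<in> S \<Longrightarrow> g x \<le> a" for a x
    unfolding u_def using vS that by (intro cSUP_least) auto
  have uw: "v x \<le> u x \<and> u x \<le> w x" if "x \<in> V" for x
    using upper[OF vS that] least[of x "w x"] that by (auto simp: S_def)
  have bu: "bounded (u ` V)" using between uw by blast
  have Su: "u x \<le> tug_step E f u x" if x: "x \<in> V" for x
  proof (rule least)
    fix g assume g: "g \<in> S"
    then have "g x \<le> tug_step E f g x" using x by (simp add: S_def)
    also have "\<dots> \<le> tug_step E f u x + 0"
      by (rule tug_step_mono[OF _ bu _ x]) (use g upper between in \<open>auto simp: S_def\<close>)
    finally show "g x \<le> tug_step E f u x" by simp
  qed
  have "tug_step E f u \<in> S"
    unfolding S_def
  proof (clarify, intro conjI)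
    fix x assume x: "x \<in> V"
    show "v x \<le> tug_step E f u x" using uw[OF x] Su[OF x] by linarith
    have "tug_step E f u x \<le> tug_step E f w x + 0"
      by (rule tug_step_mono[OF bu w _ x]) (use uw in auto)
    then show "tug_step E f u x \<le> w x" using super[OF x] by linarith
    have "tug_step E f u x \<le> tug_step E f (tug_step E f u) x + 0"
      by (rule tug_step_mono[OF bu bounded_tug_step[OF bu] _ x]) (use Su in auto)
    then show "tug_step E f u x \<le> tug_step E f (tug_step E f u) x" by simp
  qed
  then have "tug_step E f u x = u x" if "x \<in> V" for x
    using upper[of "tug_step E f u" x] Su[OF that] that by force
  with bu that show thesis by blast
qed

section \<open>Existence of the advantage on graphs of finite diameter\<close>

text \<open>
  Pulling towards \<open>z\<close> makes the graph distance to \<open>z\<close> a reflected walk on \<open>{0..D}\<close> whose expected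
  time to reach \<open>0\<close> from \<open>j\<close> is at most \<open>j (2 D + 1 - j)\<close>; this is where the barrier comes from.
\<close>

lemma game_value_oscillation:
  assumes diam: "\<And>x z. x \<in> V \<Longrightarrow> z \<in> V \<Longrightarrow> \<exists>n\<le>D. (x, z) \<in> E ^^ n"
  obtains C where "\<And>n x z. x \<in> V \<Longrightarrow> z \<in> V \<Longrightarrow>
      \<bar>game_value E f (\<lambda>_. 0) n x - game_value E f (\<lambda>_. 0) n z\<bar> \<le> C"
proof -
  let ?u = "game_value E f (\<lambda>_. 0)"
  have b0: "bounded ((\<lambda>_. 0::real) ` V)" by (auto simp: image_constant_conv)
  have bu: "bounded (?u n ` V)" for n by (rule bounded_game_value[OF b0])
  obtain K where K: "\<And>x. x \<in> V \<Longrightarrow> \<bar>?u 1 x\<bar> \<le> K" using bu[of 1] by (auto simp: bounded_image_real)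
  obtain F where F: "\<And>x. x \<in> V \<Longrightarrow> \<bar>f x\<bar> \<le> F" using bounded_payoff by (auto simp: bounded_image_real)
  have incr: "\<bar>?u (Suc n) x - ?u n x\<bar> \<le> K" if "x \<in> V" for n x
  proof -
    have eq: "?u (Suc n) = game_value E f (?u 1) n" using game_value_add[of E f _ 1 n] by simp
    show ?thesis unfolding eq
      by (rule game_value_nonexpansive[OF bu b0 _ that]) (use K in simp)
  qed
  \<comment> \<open>The cost of one move: \<open>K\<close> for replacing time \<open>n\<close> by
    \<open>Suc n\<close> at \<open>z\<close>, and \<open>F\<close> for the running payoff.\<close>
  define A where "A = K + F"
  have A: "0 \<le> A" using K F graph unfolding A_def undirected_graph_def
    by (metis abs_ge_zero add_nonneg_nonneg all_not_in_conv order_trans)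
  define \<phi> where "\<phi> j = A * real j * (2 * real D + 1 - real j)" for j
  \<comment> \<open>The range extends to \<open>D + 1\<close>, the bound available for a neighbour
    of a vertex at distance \<open>D\<close>. The parabola peaks at \<open>D + 1/2\<close>, so it
    does not decrease between these integers.\<close>
  have \<phi>_mono: "\<phi> i \<le> \<phi> j" if "i \<le> j" "j \<le> D + 1" for i j
  proof (cases "i = j")
    case False
    have "\<phi> j - \<phi> i = A * ((real j - real i) * (2 * real D + 1 - (real i + real j)))"
      by (simp add: \<phi>_def algebra_simps)
    moreover have "0 \<le> A * ((real j - real i) * (2 * real D + 1 - (real i + real j)))"
      using that False A by (intro mult_nonneg_nonneg) auto
    ultimately show ?thesis by linarith
  qed simp
  \<comment> \<open>The second difference is \<open>- 2 * A\<close>: averaging over one step closer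
    and one step further gains exactly the cost \<open>A\<close> of a move.\<close>
  have \<phi>_step: "(\<phi> i + \<phi> (Suc (Suc i))) / 2 = \<phi> (Suc i) - A" for i
    by (simp add: \<phi>_def field_simps)
  have \<phi>0: "0 \<le> \<phi> j" if "j \<le> D + 1" for j using \<phi>_mono[of 0 j] that by (simp add: \<phi>_def)
  have \<phi>D: "\<phi> (D + 1) = \<phi> D" by (simp add: \<phi>_def algebra_simps)
  have main: "?u n x \<ge> ?u n z - \<phi> D" if x: "x \<in> V" and z: "z \<in> V" for n x z
  proof -
    define \<rho> where "\<rho> x = (LEAST n. (x, z) \<in> E ^^ n)" for x
    have \<rho>: "(x, z) \<in> E ^^ \<rho> x" if "x \<in> V" for x
      unfolding \<rho>_def using diam[OF that z] by (meson LeastI)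
    have \<rho>_le: "\<rho> x \<le> n" if "(x, z) \<in> E ^^ n" for x n
      unfolding \<rho>_def using that by (rule Least_le)
    have \<rho>D: "\<rho> x \<le> D" if "x \<in> V" for x using diam[OF that z] \<rho>_le by (meson order_trans)
    have "?u n x \<ge> ?u n z - \<phi> (\<rho> x)" using x
    proof (induction n arbitrary: x)
      case 0
      then show ?case using \<phi>0[of "\<rho> x"] \<rho>D[of x] by simp
    next
      case (Suc n)
      show ?case
      proof (cases "\<rho> x")
        case 0
        then have "x = z" using \<rho>[OF Suc.prems] by simp
        then show ?thesis using \<phi>0[of "\<rho> x"] \<rho>D[OF Suc.prems] by simp
      next
        case (Suc i)
        then obtain y where y: "(x, y) \<in> E" "(y, z) \<in> E ^^ i"
          using \<rho>[OF Suc.prems] relpow_Suc_D2 by metis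
        have yV: "y \<in> V" using y nbr_sub[of x] by blast
        have iD: "Suc i \<le> D" using \<rho>D[OF Suc.prems] Suc by simp
        have "?u n z - \<phi> i \<le> ?u n z - \<phi> (\<rho> y)" using \<phi>_mono[OF \<rho>_le[OF y(2)]] iD by simp
        also have "\<dots> \<le> ?u n y" by (rule Suc.IH[OF yV])
        also have "\<dots> \<le> (SUP y\<in>E `` {x}. ?u n y)"
          by (rule cSUP_upper) (use y bdd_nbr[OF bu] in auto)
        finally have 1: "?u n z - \<phi> i \<le> (SUP y\<in>E `` {x}. ?u n y)" .
        have 2: "?u n z - \<phi> (Suc (Suc i)) \<le> (INF y\<in>E `` {x}. ?u n y)"
        proof (rule cINF_greatest[OF nbr_nonempty[OF Suc.prems]])
          fix p assume p: "p \<in> E `` {x}"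
          then have "(p, x) \<in> E" using graph by (auto simp: undirected_graph_def dest: symD)
          then have "(p, z) \<in> E ^^ Suc (\<rho> x)" using \<rho>[OF Suc.prems] by (metis relpow_Suc_I2)
          then have "\<rho> p \<le> Suc (Suc i)" using \<rho>_le Suc by simp
          then have "\<phi> (\<rho> p) \<le> \<phi> (Suc (Suc i))" using \<phi>_mono iD by simp
          moreover have "?u n z - \<phi> (\<rho> p) \<le> ?u n p" using Suc.IH p nbr_sub[of x] by blast
          ultimately show "?u n z - \<phi> (Suc (Suc i)) \<le> ?u n p" by linarith
        qed
        \<comment> \<open>The supremum is at least the value at a vertex one step closer to
          \<open>z\<close>, and no neighbour is more than one step further away.\<close>
        have "?u n z - (\<phi> i + \<phi> (Suc (Suc i))) / 2 + f x \<le> ?u (Suc n) x"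
          using 1 2 unfolding game_value_Suc tug_step_def by argo
        then show ?thesis
          using incr[OF z, of n] F[OF Suc.prems] unfolding \<phi>_step Suc A_def by linarith
      qed
    qed
    then show ?thesis using \<phi>_mono[of "\<rho> x" D] \<rho>D[OF x] by simp
  qed
  have "\<bar>?u n x - ?u n z\<bar> \<le> \<phi> D" if "x \<in> V" "z \<in> V" for n x z
    using main[of x z n] main[of z x n] that by linarith
  then show thesis by (rule that)
qed

lemma bounded_advantage_exists:
  assumes diam: "\<And>x z. x \<in> V \<Longrightarrow> z \<in> V \<Longrightarrow> \<exists>n\<le>D. (x, z) \<in> E ^^ n"
  obtains c where "bounded_advantage V E f c"
proof -
  let ?u = "game_value E f (\<lambda>_. 0)"
  have b0: "bounded ((\<lambda>_. 0::real) ` V)" by (auto simp: image_constant_conv)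
  have bu: "bounded (?u n ` V)" for n by (rule bounded_game_value[OF b0])
  obtain C where C: "\<And>n x z. x \<in> V \<Longrightarrow> z \<in> V \<Longrightarrow> \<bar>?u n x - ?u n z\<bar> \<le> C"
    using game_value_oscillation[OF diam] by metis
  obtain z where z: "z \<in> V" using graph by (auto simp: undirected_graph_def)
  have "\<bar>?u (m + n) z - ?u m z - ?u n z\<bar> \<le> C" for m n
  proof -
    \<comment> \<open>Replacing \<open>?u m\<close> by its value at \<open>z\<close> costs at most
      the oscillation. The constant is written \<open>0 + ?u m z\<close> so that
      \<open>game_value_add_const\<close> sees a shift of the zero payoff.\<close>
    have bk: "bounded ((\<lambda>y. 0 + ?u m z) ` V)" by (auto simp: image_constant_conv)
    have "\<bar>game_value E f (?u m) n z - game_value E f (\<lambda>y. 0 + ?u m z) n z\<bar> \<le> C"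
      by (rule game_value_nonexpansive[OF bu bk _ z]) (use C z in auto)
    then show ?thesis unfolding game_value_add game_value_add_const[OF b0 z] by linarith
  qed
  then obtain c where c: "\<And>n. \<bar>?u n z - real n * c\<bar> \<le> C"
    using quasi_additive_imp_linear[of "\<lambda>n. ?u n z" C] by metis
  have "bounded_advantage V E f c"
    unfolding bounded_advantage_def
  proof (intro allI impI)
    fix u0 :: "'a \<Rightarrow> real" assume u0: "bounded (u0 ` V)"
    then obtain B0 where B0: "\<And>x. x \<in> V \<Longrightarrow> \<bar>u0 x\<bar> \<le> B0" by (auto simp: bounded_image_real)
    have "\<bar>game_value E f u0 n x - real n * c\<bar> \<le> B0 + 2 * C" if x: "x \<in> V" for n x
    proof -
      have "\<bar>game_value E f u0 n x - ?u n x\<bar> \<le> B0"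
        by (rule game_value_nonexpansive[OF u0 b0 _ x]) (use B0 in simp)
      then show ?thesis using c[of n] C[OF x z, of n] by linarith
    qed
    then show "\<exists>B. \<forall>n. \<forall>x\<in>V. \<bar>game_value E f u0 n x - real n * c\<bar> \<le> B" by blast
  qed
  then show thesis by (rule that)
qed

text \<open>A walk enters the finite net \<open>C\<close> by at most one edge, crosses between two
  net points in at most \<open>L\<close> edges, and leaves by at most one more. The net is a finite
  set of ball centres in the metric case and \<open>V\<close> itself in the finite case.\<close>

lemma finite_diameter:
  assumes conn: "\<And>x y. x \<in> V \<Longrightarrow> y \<in> V \<Longrightarrow> (x, y) \<in> E\<^sup>*"
    and C: "finite C" "C \<subseteq> V" "V \<subseteq> C \<union> E `` C"
  obtains D where "\<And>x z. x \<in> V \<Longrightarrow> z \<in> V \<Longrightarrow> \<exists>n\<le>D. (x, z) \<in> E ^^ n"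
proof -
  have "\<exists>n. (fst p, snd p) \<in> E ^^ n" if "p \<in> C \<times> C" for p
    using that conn C(2) by (intro rtrancl_imp_relpow) auto
  then obtain n where n: "\<And>p. p \<in> C \<times> C \<Longrightarrow> (fst p, snd p) \<in> E ^^ n p" by metis
  obtain L where L: "\<And>p. p \<in> C \<times> C \<Longrightarrow> n p \<le> L"
    using C(1) finite_nat_set_iff_bounded_le[of "n ` (C \<times> C)"] by auto
  have to_C: "\<exists>c\<in>C. \<exists>i\<le>1. (c, x) \<in> E ^^ i \<and> (x, c) \<in> E ^^ i" if x: "x \<in> V" for x
  proof (cases "x \<in> C")
    case True
    then show ?thesis by (intro bexI[of _ x] exI[of _ 0]) auto
  next
    case False
    then obtain c where "c \<in> C" "(c, x) \<in> E" using C(3) x by blast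
    moreover from this have "(x, c) \<in> E" using graph by (auto simp: undirected_graph_def dest: symD)
    ultimately show ?thesis by (intro bexI[of _ c] exI[of _ 1]) auto
  qed
  have "\<exists>n\<le>L + 2. (x, z) \<in> E ^^ n" if xz: "x \<in> V" "z \<in> V" for x z
  proof -
    obtain a i where a: "a \<in> C" "i \<le> 1" "(x, a) \<in> E ^^ i" using to_C[OF xz(1)] by blast
    obtain b j where b: "b \<in> C" "j \<le> 1" "(b, z) \<in> E ^^ j" using to_C[OF xz(2)] by blast
    have "(x, z) \<in> E ^^ (i + n (a, b) + j)"
      using a b n[of "(a, b)"] unfolding relpow_add by auto
    then show ?thesis using a(2) b(2) L[of "(a, b)"] a(1) b(1) by (intro exI[of _ "i + n (a, b) + j"]) auto
  qed
  then show thesis by (rule that)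
qed

section \<open>Solutions and bounded fixed points\<close>

lemma solution_imp_fixed_point:
  assumes "is_solution V E f u" "x \<in> V"
  shows "tug_step E f u x = u x"
proof -
  obtain y z where y: "is_arg_min u (\<lambda>w. (x, w) \<in> E) y" and z: "is_arg_max u (\<lambda>w. (x, w) \<in> E) z"
    and eq: "u x - (u y + u z) / 2 = f x"
    using assms unfolding is_solution_def by blast
  have "(INF w\<in>E `` {x}. u w) = u y"
    by (rule cInf_eq_minimum) (use y in \<open>auto simp: is_arg_min_def not_less\<close>)
  moreover have "(SUP w\<in>E `` {x}. u w) = u z"
    by (rule cSup_eq_maximum) (use z in \<open>auto simp: is_arg_max_def not_less\<close>)
  ultimately show ?thesis using eq unfolding tug_step_def by argo
qed

lemma fixed_point_imp_solution:
  assumes fp: "\<And>x. x \<in> V \<Longrightarrow> tug_step E f u x = u x"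
    and cpt: "\<And>x. x \<in> V \<Longrightarrow> compact (u ` (E `` {x}))"
  shows "is_solution V E f u"
  unfolding is_solution_def
proof
  fix x assume x: "x \<in> V"
  have ne: "u ` (E `` {x}) \<noteq> {}" using nbr_nonempty[OF x] by blast
  obtain y where y: "(x, y) \<in> E" "\<And>w. (x, w) \<in> E \<Longrightarrow> u y \<le> u w"
    using compact_attains_inf[OF cpt[OF x] ne] by auto
  obtain z where z: "(x, z) \<in> E" "\<And>w. (x, w) \<in> E \<Longrightarrow> u w \<le> u z"
    using compact_attains_sup[OF cpt[OF x] ne] by auto
  have "(INF w\<in>E `` {x}. u w) = u y" by (rule cInf_eq_minimum) (use y in auto)
  moreover have "(SUP w\<in>E `` {x}. u w) = u z" by (rule cSup_eq_maximum) (use z in auto)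
  ultimately have "u x - (u y + u z) / 2 = f x" using fp[OF x] unfolding tug_step_def by argo
  moreover have "is_arg_min u (\<lambda>w. (x, w) \<in> E) y" using y by (auto simp: is_arg_min_def not_less)
  moreover have "is_arg_max u (\<lambda>w. (x, w) \<in> E) z" using z by (auto simp: is_arg_max_def not_less)
  ultimately show "\<exists>y z. is_arg_min u (\<lambda>w. (x, w) \<in> E) y \<and> is_arg_max u (\<lambda>w. (x, w) \<in> E) z \<and>
      u x - (u y + u z) / 2 = f x" by blast
qed

text \<open>Solutions are not assumed bounded, but attained extrema bound \<open>u\<close> on each
  neighbourhood, and finitely many neighbourhoods together with \<open>C\<close> cover
  \<open>V\<close>.\<close>

lemma solution_bounded:
  assumes u: "is_solution V E f u" and C: "finite C" "C \<subseteq> V" "V \<subseteq> C \<union> E `` C"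
  shows "bounded (u ` V)"
proof -
  have "bounded (u ` (E `` {c}))" if c: "c \<in> C" for c
  proof -
    obtain y z where "is_arg_min u (\<lambda>w. (c, w) \<in> E) y" "is_arg_max u (\<lambda>w. (c, w) \<in> E) z"
      using u c C(2) unfolding is_solution_def by blast
    then have "u ` (E `` {c}) \<subseteq> {u y..u z}" by (auto simp: is_arg_min_def is_arg_max_def not_less)
    then show ?thesis using bounded_closed_interval bounded_subset by blast
  qed
  then have "bounded (u ` C \<union> (\<Union>c\<in>C. u ` (E `` {c})))"
    using C(1) bounded_UN[of C "\<lambda>c. u ` (E `` {c})"] by (simp add: finite_imp_bounded)
  moreover have "u ` V \<subseteq> u ` C \<union> (\<Union>c\<in>C. u ` (E `` {c}))" using C(3) by blast
  ultimately show ?thesis by (rule bounded_subset)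
qed

end

section \<open>Half-relaxed limits on compact graphs\<close>

text \<open>The limsup in time and space jointly, given by the properties through which it is used.
  One index \<open>k\<close> serves both as time threshold and, through
  \<open>inverse (real (Suc k))\<close>, as radius.\<close>

lemma upper_relaxed_limit:
  fixes u :: "nat \<Rightarrow> 'a \<Rightarrow> real"
  assumes "Metric_space M d" and B: "\<And>n x. x \<in> M \<Longrightarrow> \<bar>u n x\<bar> \<le> B"
  obtains v where "\<And>x. x \<in> M \<Longrightarrow> \<bar>v x\<bar> \<le> B"
    and "\<And>x a. x \<in> M \<Longrightarrow> v x < a \<Longrightarrow>
           \<exists>k. \<forall>n\<ge>k. \<forall>y\<in>M. d x y < inverse (real (Suc k)) \<longrightarrow> u n y < a"
    and "\<And>x a k. x \<in> M \<Longrightarrow>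
           (\<And>n y. n \<ge> k \<Longrightarrow> y \<in> M \<Longrightarrow> d x y < inverse (real (Suc k)) \<Longrightarrow> u n y \<le> a) \<Longrightarrow> v x \<le> a"
proof -
  interpret Metric_space M d by fact
  define P where "P x k = {k..} \<times> {y \<in> M. d x y < inverse (real (Suc k))}" for x k
  define s where "s x k = (SUP p\<in>P x k. u (fst p) (snd p))" for x k
  define v where "v x = (INF k. s x k)" for x
  have self: "(k, x) \<in> P x k" if "x \<in> M" for x k using that by (auto simp: P_def)
  have s_upper: "u n y \<le> s x k" if "(n, y) \<in> P x k" for n y x k
    unfolding s_def
  proof (rule cSUP_upper2[OF _ that])
    show "bdd_above ((\<lambda>p. u (fst p) (snd p)) ` P x k)"
      using B by (intro bdd_aboveI[of _ B]) (force simp: P_def abs_le_iff)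
  qed simp
  have s_least: "s x k \<le> a" if "x \<in> M" "\<And>n y. (n, y) \<in> P x k \<Longrightarrow> u n y \<le> a" for x k a
    unfolding s_def using self[OF that(1), of k] that(2) by (intro cSUP_least) auto
  have s_lower: "- B \<le> s x k" if "x \<in> M" for x k
    using s_upper[OF self[OF that]] B[OF that, of k] by (smt (verit))
  have bd: "bdd_below (range (s x))" if "x \<in> M" for x
    using s_lower[OF that] by (intro bdd_belowI[of _ "- B"]) auto
  show thesis
  proof
    fix x assume x: "x \<in> M"
    have "v x \<le> s x 0" unfolding v_def by (rule cINF_lower[OF bd[OF x]]) simp
    also have "s x 0 \<le> B" by (rule s_least[OF x]) (use B in \<open>force simp: P_def abs_le_iff\<close>)
    finally have "v x \<le> B" .
    moreover have "- B \<le> v x" unfolding v_def by (rule cINF_greatest) (use s_lower[OF x] in auto)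
    ultimately show "\<bar>v x\<bar> \<le> B" by linarith
  next
    fix x a assume x: "x \<in> M" and "v x < a"
    then obtain k where "s x k < a"
      unfolding v_def using cINF_less_iff[OF _ bd[OF x], of a] by auto
    then show "\<exists>k. \<forall>n\<ge>k. \<forall>y\<in>M. d x y < inverse (real (Suc k)) \<longrightarrow> u n y < a"
      using s_upper[of _ _ x k] by (intro exI[of _ k]) (force simp: P_def)
  next
    fix x a k assume x: "x \<in> M"
      and *: "\<And>n y. n \<ge> k \<Longrightarrow> y \<in> M \<Longrightarrow> d x y < inverse (real (Suc k)) \<Longrightarrow> u n y \<le> a"
    have "v x \<le> s x k" unfolding v_def by (rule cINF_lower[OF bd[OF x]]) simp
    also have "s x k \<le> a" by (rule s_least[OF x]) (use * in \<open>auto simp: P_def\<close>)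
    finally show "v x \<le> a" .
  qed
qed

text \<open>The properties shared by adjacency graphs and finite graphs with the discrete metric.
  \<open>nbr_transfer\<close> says that neighbourhoods move no faster than their centres.\<close>

locale compact_payoff_graph = payoff_graph V E f + Metric_space V d
  for V :: "'a set" and E :: "'a rel" and f :: "'a \<Rightarrow> real" and d :: "'a \<Rightarrow> 'a \<Rightarrow> real" +
  assumes compact: "compact_space mtopology"
    and closed_nbr: "x \<in> V \<Longrightarrow> closedin mtopology (E `` {x})"
    and nbr_transfer: "x \<in> V \<Longrightarrow> x' \<in> V \<Longrightarrow> (x, y) \<in> E \<Longrightarrow> d x x' < \<delta> \<Longrightarrow>
           \<exists>y'. (x', y') \<in> E \<and> d y y' < \<delta>"
    and payoff_continuous: "x \<in> V \<Longrightarrow> \<eta> > 0 \<Longrightarrow> \<exists>\<delta>>0. \<forall>x'\<in>V. d x x' < \<delta> \<longrightarrow> \<bar>f x' - f x\<bar> < \<eta>"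
begin

lemma compactin_nbr: "x \<in> V \<Longrightarrow> compactin mtopology (E `` {x})"
  using closed_nbr closedin_compact_space compact by blast

text \<open>The upper relaxed limit inherits the inequality. For the infimum it suffices to transfer
  a fixed neighbour of \<open>x\<close> to nearby centres; for the supremum compactness is
  used.\<close>

lemma subsolution_exists:
  assumes B: "\<And>n x. x \<in> V \<Longrightarrow> \<bar>u n x\<bar> \<le> B"
    and step: "\<And>n x. x \<in> V \<Longrightarrow> u (Suc n) x \<le> tug_step E f (u n) x"
  obtains v where "bounded (v ` V)" "\<And>x. x \<in> V \<Longrightarrow> v x \<le> tug_step E f v x"
proof -
  have bu: "bounded (u n ` V)" for n using B by (auto simp: bounded_image_real)
  obtain v where vB: "\<And>x. x \<in> V \<Longrightarrow> \<bar>v x\<bar> \<le> B"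
    and v_less: "\<And>x a. x \<in> V \<Longrightarrow> v x < a \<Longrightarrow>
           \<exists>k. \<forall>n\<ge>k. \<forall>y\<in>V. d x y < inverse (real (Suc k)) \<longrightarrow> u n y < a"
    and v_le: "\<And>x a k. x \<in> V \<Longrightarrow>
           (\<And>n y. n \<ge> k \<Longrightarrow> y \<in> V \<Longrightarrow> d x y < inverse (real (Suc k)) \<Longrightarrow> u n y \<le> a) \<Longrightarrow> v x \<le> a"
    using upper_relaxed_limit[of V d u B, OF Metric_space_axioms B] by blast
  have bv: "bounded (v ` V)" using vB by (auto simp: bounded_image_real)
  have small: "d p q < inverse (real (Suc k))" if "d p q < inverse (real (Suc m))" "k \<le> m" for p q k m
    using that by (meson inverse_Suc le_imp_inverse_le less_le_trans of_nat_le_iff of_nat_0_less_iff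
        Suc_le_mono zero_less_Suc)
  have "v x \<le> tug_step E f v x" if x: "x \<in> V" for x
  proof -
    define S where "S = (SUP y\<in>E `` {x}. v y)"
    have vS: "v y \<le> S" if "(x, y) \<in> E" for y
      unfolding S_def by (rule cSUP_upper) (use that bdd_nbr[OF bv] in auto)
    \<comment> \<open>Were this false, the offending points \<open>y k\<close>, transferred to
      neighbours of \<open>x\<close>, would cluster at some neighbour \<open>l\<close>,
      contradicting \<open>v l \<le> S\<close>.\<close>
    have sup_part: "\<exists>k. \<forall>n\<ge>k. \<forall>x'\<in>V. \<forall>y. d x x' < inverse (real (Suc k)) \<longrightarrow> (x', y) \<in> E
        \<longrightarrow> u n y < S + \<eta>" if \<eta>: "\<eta> > 0" for \<eta>
    proof (rule ccontr)
      assume "\<not> ?thesis"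
      then have "\<forall>k. \<exists>n x' y. n \<ge> k \<and> x' \<in> V \<and> d x x' < inverse (real (Suc k)) \<and> (x', y) \<in> E
          \<and> S + \<eta> \<le> u n y"
        by (meson not_less)
      then obtain n x' y where seq: "\<And>k. n k \<ge> k" "\<And>k. x' k \<in> V"
          "\<And>k. d x (x' k) < inverse (real (Suc k))" "\<And>k. (x' k, y k) \<in> E"
          "\<And>k. S + \<eta> \<le> u (n k) (y k)"
        by metis
      have yV: "y k \<in> V" for k using seq(4)[of k] nbr_sub[of "x' k"] by blast
      have "\<exists>y'. (x, y') \<in> E \<and> d (y k) y' < inverse (real (Suc k))" for k
        by (rule nbr_transfer[OF seq(2) x seq(4)]) (use seq(3) commute in simp)
      then obtain y' where y': "\<And>k. (x, y' k) \<in> E" "\<And>k. d (y k) (y' k) < inverse (real (Suc k))"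
        by metis
      have "range y' \<subseteq> E `` {x}" using y' by auto
      then obtain l r where l: "(x, l) \<in> E" "strict_mono r"
          "limitin mtopology (y' \<circ> r) l sequentially"
        using compactin_nbr[OF x] unfolding compactin_sequentially by blast
      have lV: "l \<in> V" using l nbr_sub[of x] by blast
      have "v l < S + \<eta>" using vS[OF l(1)] \<eta> by simp
      then obtain k where k: "\<And>n y. n \<ge> k \<Longrightarrow> y \<in> V \<Longrightarrow> d l y < inverse (real (Suc k)) \<Longrightarrow> u n y < S + \<eta>"
        using v_less[OF lV] by blast
      \<comment> \<open>Half of the radius at \<open>l\<close>: one half for moving \<open>y\<close>
        to \<open>y'\<close>, the other for the distance from \<open>y'\<close> to
        \<open>l\<close>.\<close>
      define e where "e = inverse (real (Suc k)) / 2"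
      have e: "e > 0" by (simp add: e_def)
      obtain N where N: "\<And>j. j \<ge> N \<Longrightarrow> d (y' (r j)) l < e"
        using l(3) e unfolding limit_metric_sequentially by (metis comp_apply)
      obtain N' where N': "inverse (real (Suc N')) < e" using reals_Archimedean[OF e] by blast
      define j where "j = max (max N N') k"
      have rj: "j \<le> r j" using l(2) by (rule strict_mono_imp_increasing)
      have "d (y (r j)) (y' (r j)) < inverse (real (Suc N'))"
        by (rule small[OF y'(2)]) (use rj in \<open>simp add: j_def\<close>)
      then have "d (y (r j)) (y' (r j)) < e" using N' by linarith
      moreover have "d (y' (r j)) l < e" by (rule N) (simp add: j_def)
      moreover have y'V: "y' (r j) \<in> V" using y'(1) nbr_sub[of x] by blast
      ultimately have "d l (y (r j)) < inverse (real (Suc k))"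
        using triangle[OF yV[of "r j"] y'V lV] commute[of l "y (r j)"] by (simp add: e_def)
      moreover have "n (r j) \<ge> k" using seq(1)[of "r j"] rj by (simp add: j_def)
      ultimately have "u (n (r j)) (y (r j)) < S + \<eta>" using k yV by blast
      then show False using seq(5)[of "r j"] by linarith
    qed
    have "2 * (v x - f x) - S \<le> v z" if z: "(x, z) \<in> E" for z
    proof (rule field_le_epsilon)
      fix e :: real assume e: "e > 0"
      \<comment> \<open>The bound on \<open>v x\<close> below has error \<open>2 * \<eta>\<close>,
        which doubles to \<open>e\<close> when the equation is cleared of its half.\<close>
      define \<eta> where "\<eta> = e / 4"
      have \<eta>: "\<eta> > 0" using e by (simp add: \<eta>_def)
      have zV: "z \<in> V" using z nbr_sub[of x] by blast
      obtain k1 where k1: "\<And>n y. n \<ge> k1 \<Longrightarrow> y \<in> V \<Longrightarrow> d z y < inverse (real (Suc k1)) \<Longrightarrow> u n y < v z + \<eta>"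
        using v_less[OF zV, of "v z + \<eta>"] \<eta> by auto
      obtain k2 where k2: "\<And>n x' y. n \<ge> k2 \<Longrightarrow> x' \<in> V \<Longrightarrow> d x x' < inverse (real (Suc k2)) \<Longrightarrow>
          (x', y) \<in> E \<Longrightarrow> u n y < S + \<eta>"
        using sup_part[OF \<eta>] by blast
      obtain \<delta> where \<delta>: "\<delta> > 0" "\<And>x'. x' \<in> V \<Longrightarrow> d x x' < \<delta> \<Longrightarrow> \<bar>f x' - f x\<bar> < \<eta>"
        using payoff_continuous[OF x \<eta>] by blast
      obtain k3 where k3: "inverse (real (Suc k3)) < \<delta>" using reals_Archimedean[OF \<delta>(1)] by blast
      define k where "k = max (max k1 k2) k3"
      have "v x \<le> (v z + S) / 2 + f x + 2 * \<eta>"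
      \<comment> \<open>The threshold \<open>Suc k\<close> leaves room for a preceding move:
        \<open>n = Suc n'\<close> with \<open>n'\<close> still at least \<open>k\<close>.\<close>
      proof (rule v_le[OF x])
        fix n x' assume n: "Suc k \<le> n" and x': "x' \<in> V" and dx: "d x x' < inverse (real (Suc (Suc k)))"
        obtain n' where n': "n = Suc n'" "k \<le> n'" using n by (cases n) auto
        have dk: "d x x' < inverse (real (Suc k1))"
          "d x x' < inverse (real (Suc k2))" "d x x' < inverse (real (Suc k3))"
          by (rule small[OF dx], simp add: k_def)+
        obtain z' where z': "(x', z') \<in> E" "d z z' < inverse (real (Suc k1))"
          using nbr_transfer[OF x x' z dk(1)] by blast
        have z'V: "z' \<in> V" using z' nbr_sub[of x'] by blast
        have "(INF y\<in>E `` {x'}. u n' y) \<le> u n' z'"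
          by (rule cINF_lower) (use z' bdd_nbr[OF bu] in auto)
        also have "\<dots> < v z + \<eta>" using k1[OF _ z'V z'(2)] n' by (simp add: k_def)
        finally have 1: "(INF y\<in>E `` {x'}. u n' y) < v z + \<eta>" .
        have 2: "(SUP y\<in>E `` {x'}. u n' y) \<le> S + \<eta>"
        proof (rule cSUP_least[OF nbr_nonempty[OF x']])
          fix y assume "y \<in> E `` {x'}"
          then have "u n' y < S + \<eta>" using n' by (intro k2[OF _ x' dk(2)]) (auto simp: k_def)
          then show "u n' y \<le> S + \<eta>" by simp
        qed
        have 3: "f x' < f x + \<eta>" using \<delta>(2)[OF x'] dk(3) k3 by (smt (verit))
        show "u n x' \<le> (v z + S) / 2 + f x + 2 * \<eta>"
          using step[OF x', of n'] 1 2 3 unfolding n' tug_step_def by argo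
      qed
      then show "2 * (v x - f x) - S \<le> v z + e" by (simp add: \<eta>_def field_simps)
    qed
    then have "2 * (v x - f x) - S \<le> (INF y\<in>E `` {x}. v y)"
      by (intro cINF_greatest nbr_nonempty x) auto
    then show ?thesis unfolding tug_step_def S_def by argo
  qed
  with bv show thesis by (rule that)
qed

end

lemma (in compact_payoff_graph) compact_payoff_graph_uminus:
  "compact_payoff_graph V E (\<lambda>x. - f x) d"
proof unfold_locales
  show "bounded ((\<lambda>x. - f x) ` V)" using bounded_payoff by (simp add: bounded_image_real)
next
  fix x and \<eta> :: real assume "x \<in> V" "\<eta> > 0"
  then obtain \<delta> where "\<delta> > 0" "\<And>x'. x' \<in> V \<Longrightarrow> d x x' < \<delta> \<Longrightarrow> \<bar>f x' - f x\<bar> < \<eta>"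
    using payoff_continuous by blast
  then show "\<exists>\<delta>>0. \<forall>x'\<in>V. d x x' < \<delta> \<longrightarrow> \<bar>- f x' - - f x\<bar> < \<eta>"
    by (intro exI[of _ \<delta>]) (auto simp: abs_minus_commute)
qed (use graph compact closed_nbr nbr_transfer in auto)

context compact_payoff_graph
begin

lemma bounded_fixed_point_exists:
  assumes "bounded_advantage V E f 0"
  obtains u where "bounded (u ` V)" "\<And>x. x \<in> V \<Longrightarrow> tug_step E f u x = u x"
proof -
  interpret neg: compact_payoff_graph V E "\<lambda>x. - f x" d by (rule compact_payoff_graph_uminus)
  let ?u = "game_value E f (\<lambda>_. 0)"
  have b0: "bounded ((\<lambda>_. 0::real) ` V)" by (auto simp: image_constant_conv)
  obtain B where B: "\<And>n x. x \<in> V \<Longrightarrow> \<bar>?u n x\<bar> \<le> B"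
    using assms b0 unfolding bounded_advantage_def by fastforce
  obtain v where v: "bounded (v ` V)" "\<And>x. x \<in> V \<Longrightarrow> v x \<le> tug_step E f v x"
    using subsolution_exists[of ?u B] B game_value_Suc by (metis order_refl)
  \<comment> \<open>The negated orbit is an orbit for the payoff \<open>- f\<close>, so
    \<open>- w\<close> will be a supersolution for \<open>f\<close>.\<close>
  obtain w where w: "bounded (w ` V)" "\<And>x. x \<in> V \<Longrightarrow> w x \<le> tug_step E (\<lambda>x. - f x) w x"
  proof (rule neg.subsolution_exists[of "\<lambda>n x. - ?u n x" B])
    show "- ?u (Suc n) x \<le> tug_step E (\<lambda>x. - f x) (\<lambda>x. - ?u n x) x" for n x
      unfolding game_value_Suc tug_step_uminus by simp
    show "\<bar>- ?u n x\<bar> \<le> B" if "x \<in> V" for n x using B[OF that] by simp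
  qed (rule that)
  obtain Bv where Bv: "\<And>x. x \<in> V \<Longrightarrow> \<bar>v x\<bar> \<le> Bv" using v by (auto simp: bounded_image_real)
  obtain Bw where Bw: "\<And>x. x \<in> V \<Longrightarrow> \<bar>w x\<bar> \<le> Bw" using w by (auto simp: bounded_image_real)
  \<comment> \<open>The constant lifts \<open>- w\<close> above \<open>v\<close>.\<close>
  define w' where "w' x = - w x + (Bv + Bw)" for x
  have bw: "bounded ((\<lambda>x. - w x) ` V)" using w(1) by (simp add: bounded_image_real)
  have bw': "bounded (w' ` V)"
  proof -
    have "\<bar>w' x\<bar> \<le> Bv + 2 * Bw" if "x \<in> V" for x
      using Bv[OF that] Bw[OF that] unfolding w'_def by linarith
    then show ?thesis by (auto simp: bounded_image_real)
  qed
  show thesis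
  proof (rule fixed_point_between[OF v(1) bw' _ v(2)])
    fix x assume x: "x \<in> V"
    show "v x \<le> w' x" using Bv[OF x] Bw[OF x] unfolding w'_def by linarith
    have "tug_step E f w' x \<le> tug_step E f (\<lambda>x. - w x) x + (Bv + Bw)"
      by (rule tug_step_mono[OF bw' bw _ x]) (simp add: w'_def)
    moreover have "w x \<le> - tug_step E f (\<lambda>x. - w x) x"
      using w(2)[OF x] tug_step_uminus[of E f "\<lambda>x. - w x" x] by simp
    ultimately show "tug_step E f w' x \<le> w' x" unfolding w'_def by linarith
  qed (blast intro: that)+
qed

section \<open>Uniform continuity of bounded fixed points\<close>

text \<open>
  Suppose the limit \<open>M\<close> of the modulus of continuity of \<open>u\<close> at \<open>0\<close> is positive. If \<open>x\<close>, \<open>x'\<close> are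
  close and \<open>u x - u x'\<close> is almost \<open>M\<close>, then the equation forces both the suprema and the infima
  over the two neighbourhoods to differ by almost \<open>M\<close>. A near-maximiser \<open>y\<close> for \<open>x\<close> then belongs to
  a pair of the same kind, while \<open>u y\<close> exceeds \<open>u x\<close> by almost \<open>M\<close> because \<open>x\<close> is a neighbour of
  \<open>x'\<close>. Iterating contradicts the boundedness of \<open>u\<close>.
\<close>

lemma fixed_point_uniformly_continuous:
  assumes bu: "bounded (u ` V)" and fp: "\<And>x. x \<in> V \<Longrightarrow> tug_step E f u x = u x"
    and near: "r > 0" "\<And>x y. x \<in> V \<Longrightarrow> y \<in> V \<Longrightarrow> d x y < r \<Longrightarrow> (x, y) \<in> E"
    and f_uc: "\<And>\<eta>. \<eta> > 0 \<Longrightarrow> \<exists>\<delta>>0. \<forall>x\<in>V. \<forall>y\<in>V. d x y < \<delta> \<longrightarrow> f x - f y < \<eta>"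
    and "\<eta> > 0"
  shows "\<exists>\<delta>>0. \<forall>x\<in>V. \<forall>y\<in>V. d x y < \<delta> \<longrightarrow> u x - u y < \<eta>"
proof -
  obtain B where B: "\<And>x. x \<in> V \<Longrightarrow> \<bar>u x\<bar> \<le> B" using bu by (auto simp: bounded_image_real)
  obtain p where p: "p \<in> V" using graph by (auto simp: undirected_graph_def)
  \<comment> \<open>Bounds for the differences of \<open>u\<close> at some positive scale; their
    infimum is the limit of the modulus of continuity at 0.\<close>
  define A where "A = {a. \<exists>\<delta>>0. \<forall>x\<in>V. \<forall>y\<in>V. d x y < \<delta> \<longrightarrow> u x - u y \<le> a}"
  define M where "M = Inf A"
  have A_nonneg: "0 \<le> a" if "a \<in> A" for a
    using that p p mdist_zero[OF p] unfolding A_def by fastforce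
  then have bdA: "bdd_below A" by (rule bdd_belowI)
  have "u x - u y \<le> 2 * B" if "x \<in> V" "y \<in> V" for x y using B[OF that(1)] B[OF that(2)] by linarith
  then have "2 * B \<in> A" unfolding A_def by (auto intro: exI[of _ 1])
  then have neA: "A \<noteq> {}" by blast
  have upper: "\<exists>\<delta>>0. \<forall>x\<in>V. \<forall>y\<in>V. d x y < \<delta> \<longrightarrow> u x - u y < M + e" if "e > 0" for e
  proof -
    obtain a where "a \<in> A" "a < M + e"
      using cInf_lessD[OF neA, of "M + e"] \<open>e > 0\<close> unfolding M_def by auto
    then show ?thesis unfolding A_def by fastforce
  qed
  have pairs: "\<exists>x\<in>V. \<exists>y\<in>V. d x y < \<delta> \<and> u x - u y > M - e" if "e > 0" "\<delta> > 0" for e \<delta>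
  proof (rule ccontr)
    assume "\<not> ?thesis"
    then have "M - e \<in> A" unfolding A_def using \<open>\<delta> > 0\<close> by (force simp: not_less)
    then have "M \<le> M - e" unfolding M_def by (rule cInf_lower[OF _ bdA])
    then show False using \<open>e > 0\<close> by simp
  qed
  have "M \<le> 0"
  proof (rule ccontr)
    assume "\<not> M \<le> 0"
    then have M: "M > 0" by simp
    \<comment> \<open>All \<open>e\<close> and \<open>\<delta>\<close> are quantified inside the
      induction because each climb uses a pair of finer precision and scale.\<close>
    have climb: "\<forall>e>0. \<forall>\<delta>>0. \<exists>x\<in>V. \<exists>y\<in>V. d x y < \<delta> \<and> u x - u y > M - e
        \<and> u x \<ge> real k * (M / 2) - B" for k
    proof (induction k)
      case 0
      have "- B \<le> u x" if "x \<in> V" for x using B[OF that] by linarith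
      then show ?case using pairs by fastforce
    next
      case (Suc k)
      show ?case
      proof (intro allI impI)
        fix e \<delta> :: real assume e: "e > 0" and \<delta>: "\<delta> > 0"
        \<comment> \<open>Up to \<open>7 * e1\<close> is lost below: 6 in comparing suprema and 1 in
          choosing \<open>y\<close>. The factor 8 keeps this below both \<open>e\<close> and
          \<open>M / 2\<close>.\<close>
        define e1 where "e1 = min e (M / 2) / 8"
        have e1: "e1 > 0" "8 * e1 \<le> e" "8 * e1 \<le> M / 2" using e M by (auto simp: e1_def)
        obtain \<delta>u where \<delta>u: "\<delta>u > 0"
            "\<And>x y. x \<in> V \<Longrightarrow> y \<in> V \<Longrightarrow> d x y < \<delta>u \<Longrightarrow> u x - u y < M + e1"
          using upper[OF e1(1)] by blast
        obtain \<delta>f where \<delta>f: "\<delta>f > 0"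
            "\<And>x y. x \<in> V \<Longrightarrow> y \<in> V \<Longrightarrow> d x y < \<delta>f \<Longrightarrow> f x - f y < e1"
          using f_uc[OF e1(1)] by blast
        define \<delta>1 where "\<delta>1 = min (min \<delta> r) (min \<delta>u \<delta>f)"
        have \<delta>1: "\<delta>1 > 0" "\<delta>1 \<le> \<delta>" "\<delta>1 \<le> r" "\<delta>1 \<le> \<delta>u" "\<delta>1 \<le> \<delta>f"
          using \<delta> near \<delta>u \<delta>f by (auto simp: \<delta>1_def)
        obtain x x' where x: "x \<in> V" "x' \<in> V" "d x x' < \<delta>1" "u x - u x' > M - e1"
            "u x \<ge> real k * (M / 2) - B"
          using Suc e1(1) \<delta>1(1) by blast
        have x'x: "d x' x < \<delta>1" using x(3) commute by simp
        have "(INF y\<in>E `` {x'}. u y) < (INF y\<in>E `` {x'}. u y) + e1" using e1 by simp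
        then obtain z' where z': "(x', z') \<in> E" "u z' < (INF y\<in>E `` {x'}. u y) + e1"
          unfolding cINF_less_iff[OF nbr_nonempty[OF x(2)] bdd_nbr(2)[OF bu]] by auto
        obtain z where z: "(x, z) \<in> E" "d z' z < \<delta>1"
          using nbr_transfer[OF x(2,1) z'(1) x'x] by blast
        have "u z - u z' < M + e1"
          by (rule \<delta>u(2)) (use z z' nbr_sub \<delta>1 commute[of z z'] in \<open>auto intro: less_le_trans\<close>)
        moreover have "(INF y\<in>E `` {x}. u y) \<le> u z"
          by (rule cINF_lower) (use z bdd_nbr[OF bu] in auto)
        ultimately have inf_diff: "(INF y\<in>E `` {x}. u y) - (INF y\<in>E `` {x'}. u y) < M + 2 * e1"
          using z'(2) by linarith
        have "f x - f x' < e1" by (rule \<delta>f(2)) (use x \<delta>1 in auto)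
        \<comment> \<open>By the equation, the differences of infima and of suprema add up to more
          than \<open>2 * M - 4 * e1\<close>, and the former is below
          \<open>M + 2 * e1\<close>.\<close>
        then have sup_diff: "(SUP y\<in>E `` {x}. u y) - (SUP y\<in>E `` {x'}. u y) > M - 6 * e1"
          using inf_diff x(4) fp[OF x(1)] fp[OF x(2)] unfolding tug_step_def by argo
        have "(SUP y\<in>E `` {x}. u y) - e1 < (SUP y\<in>E `` {x}. u y)" using e1 by simp
        then obtain y where y: "(x, y) \<in> E" "(SUP y\<in>E `` {x}. u y) - e1 < u y"
          using less_cSUP_iff[OF nbr_nonempty[OF x(1)] bdd_nbr(1)[OF bu]] by auto
        obtain y' where y': "(x', y') \<in> E" "d y y' < \<delta>1"
          using nbr_transfer[OF x(1,2) y(1) x(3)] by blast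
        have upp: "u q \<le> (SUP y\<in>E `` {x'}. u y)" if "(x', q) \<in> E" for q
          by (rule cSUP_upper) (use that bdd_nbr[OF bu] in auto)
        have "(x', x) \<in> E" by (rule near(2)) (use x x'x \<delta>1 in auto)
        then have "u x \<le> (SUP y\<in>E `` {x'}. u y)" by (rule upp)
        then have "u y \<ge> u x + M / 2" using y(2) sup_diff e1 by linarith
        then have "u y \<ge> real (Suc k) * (M / 2) - B" using x(5) by (simp add: algebra_simps)
        moreover have "u y - u y' > M - e" using upp[OF y'(1)] y(2) sup_diff e1 by linarith
        moreover have "y \<in> V" "y' \<in> V" using y y' nbr_sub by blast+
        moreover have "d y y' < \<delta>" using y'(2) \<delta>1 by simp
        ultimately show "\<exists>x\<in>V. \<exists>y\<in>V. d x y < \<delta> \<and> u x - u y > M - e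
            \<and> u x \<ge> real (Suc k) * (M / 2) - B"
          by blast
      qed
    qed
    obtain k where "2 * B < real k * (M / 2)" using reals_Archimedean3[of "M / 2"] M half_gt_zero by blast
    moreover obtain x where "x \<in> V" "u x \<ge> real k * (M / 2) - B"
      using climb[of k] by (meson zero_less_one)
    ultimately show False using B[of x] by linarith
  qed
  with upper[OF \<open>\<eta> > 0\<close>] show ?thesis by (smt (verit))
qed

text \<open>Attainment enters through \<open>cpt\<close>: uniform continuity provides it on
  adjacency graphs, finiteness of the neighbourhoods on finite graphs.\<close>

lemma solvable_iff:
  assumes conn: "\<And>x y. x \<in> V \<Longrightarrow> y \<in> V \<Longrightarrow> (x, y) \<in> E\<^sup>*"
    and C: "finite C" "C \<subseteq> V" "V \<subseteq> C \<union> E `` C"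
    and cpt: "\<And>u x. bounded (u ` V) \<Longrightarrow> (\<And>x. x \<in> V \<Longrightarrow> tug_step E f u x = u x) \<Longrightarrow> x \<in> V
      \<Longrightarrow> compact (u ` (E `` {x}))"
  shows "(\<exists>u. is_solution V E f u) \<longleftrightarrow> long_term_advantage V E f = 0"
proof
  assume "\<exists>u. is_solution V E f u"
  then obtain u where u: "is_solution V E f u" by blast
  show "long_term_advantage V E f = 0"
    by (intro long_term_advantage_eq fixed_point_imp_bounded_advantage[of u]
        solution_bounded[OF u C] solution_imp_fixed_point[OF u])
next
  assume lta: "long_term_advantage V E f = 0"
  obtain D where D: "\<And>x z. x \<in> V \<Longrightarrow> z \<in> V \<Longrightarrow> \<exists>n\<le>D. (x, z) \<in> E ^^ n"
    using finite_diameter[OF conn C] by blast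
  obtain c where c: "bounded_advantage V E f c"
    using bounded_advantage_exists[OF D] by blast
  then have "bounded_advantage V E f 0" using long_term_advantage_eq[OF c] lta by simp
  then obtain u where u: "bounded (u ` V)" "\<And>x. x \<in> V \<Longrightarrow> tug_step E f u x = u x"
    using bounded_fixed_point_exists by blast
  show "\<exists>u. is_solution V E f u"
    using fixed_point_imp_solution[OF u(2) cpt[OF u]] by blast
qed

end

section \<open>Near-geodesics in length spaces\<close>

lemma mdist_chain_le_mpath_length:
  assumes "0 \<le> t" "t \<le> 1"
  shows "ereal (mdist m (g 0) (g t) + mdist m (g t) (g 1)) \<le> mpath_length m g"
  unfolding mpath_length_def
proof (rule SUP_upper2[of 2], simp)
  \<comment> \<open>The partition 0, \<open>t\<close>, 1 continued by the constant 1, as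
    \<open>mpath_length\<close> ranges over infinite monotone sequences and sums the first
    \<open>n\<close> increments.\<close>
  define s :: "nat \<Rightarrow> real" where "s i = (if i = 0 then 0 else if i = 1 then t else 1)" for i
  have "mono s" using assms by (auto simp: mono_def s_def)
  moreover have "range s \<subseteq> {0..1}" using assms by (auto simp: s_def)
  moreover have "(\<Sum>i<2. mdist m (g (s i)) (g (s (Suc i)))) = mdist m (g 0) (g t) + mdist m (g t) (g 1)"
    by (simp add: s_def numeral_2_eq_2)
  ultimately show "ereal (mdist m (g 0) (g t) + mdist m (g t) (g 1))
      \<le> (SUP t\<in>{t. mono t \<and> range t \<subseteq> {0..1}}. ereal (\<Sum>i<2. mdist m (g (t i)) (g (t (Suc i)))))"
    by (intro SUP_upper2[of s]) auto
qed

text \<open>On a path of length below \<open>mdist m x y + \<delta>\<close> the intermediate value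
  theorem finds a point at distance exactly \<open>r\<close> from \<open>x\<close>; the length bound
  controls the rest.\<close>

lemma length_space_intermediate_point:
  assumes m: "compact_length_space m" and xy: "x \<in> mspace m" "y \<in> mspace m"
    and r: "0 \<le> r" "r \<le> mdist m x y" and "\<delta> > 0"
  obtains p where "p \<in> mspace m" "mdist m x p = r" "mdist m p y < mdist m x y - r + \<delta>"
proof -
  have "(INF g\<in>rectifiable_paths m x y. mpath_length m g) < ereal (mdist m x y + \<delta>)"
    using m xy \<open>\<delta> > 0\<close> unfolding compact_length_space_def by (metis ereal_less(2) less_add_same_cancel1 less_ereal.simps(1))
  then obtain g where g: "g \<in> rectifiable_paths m x y" "mpath_length m g < ereal (mdist m x y + \<delta>)"
    unfolding INF_less_iff by blast
  then have path: "continuous_map (top_of_set {0..1}) (mtopology_of m) g" and g01: "g 0 = x" "g 1 = y"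
    by (auto simp: rectifiable_paths_def pathin_def)
  have "continuous_map (top_of_set {0..1}) euclidean (\<lambda>t. mdist m x (g t))"
    using xy by (intro continuous_map_mdist path) auto
  then have "continuous_on {0..1} (\<lambda>t. mdist m x (g t))" by simp
  moreover have "mdist m x (g 0) \<le> r" using r(1) g01(1) mdist_zero[OF xy(1) xy(1)] by (metis order_refl order_trans)
  ultimately obtain t where t: "0 \<le> t" "t \<le> 1" "mdist m x (g t) = r"
    using IVT'[of "\<lambda>t. mdist m x (g t)" 0 r 1] r g01 by auto
  have "ereal (mdist m (g 0) (g t) + mdist m (g t) (g 1)) < ereal (mdist m x y + \<delta>)"
    using mdist_chain_le_mpath_length[OF t(1,2), of m g] g(2) by (rule le_less_trans)
  then have "mdist m (g t) y < mdist m x y - r + \<delta>" using g01 t(3) by simp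
  moreover have "g t \<in> mspace m" using path t(1,2) by (auto simp: continuous_map_def Pi_iff)
  ultimately show thesis using that t(3) by blast
qed

text \<open>If \<open>y\<close> is too far from \<open>x'\<close>, a near-geodesic from
  \<open>x'\<close> towards \<open>y\<close> is stopped at distance \<open>\<epsilon>\<close>. What
  remains is about \<open>mdist m x' y - \<epsilon>\<close>, hence at most about
  \<open>mdist m x x'\<close>; the slack is \<open>\<delta> - mdist m x x'\<close>.\<close>

lemma adjacency_transfer:
  assumes m: "compact_length_space m" and "\<epsilon> > 0" and x: "x \<in> mspace m" "x' \<in> mspace m"
    and y: "(x, y) \<in> adjacency_edges m \<epsilon>" and d: "mdist m x x' < \<delta>"
  shows "\<exists>y'. (x', y') \<in> adjacency_edges m \<epsilon> \<and> mdist m y y' < \<delta>"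
proof (cases "mdist m x' y \<le> \<epsilon>")
  case True
  have "y \<in> mspace m" using y by (simp add: adjacency_edges_def)
  then have "mdist m y y < \<delta>" using d mdist_nonneg[of m x x'] mdist_zero[of y m y] by (metis le_less_trans)
  then show ?thesis using True y x by (auto simp: adjacency_edges_def)
next
  case False
  have yM: "y \<in> mspace m" "mdist m x y \<le> \<epsilon>" using y by (auto simp: adjacency_edges_def)
  obtain p where p: "p \<in> mspace m" "mdist m x' p = \<epsilon>"
      "mdist m p y < mdist m x' y - \<epsilon> + (\<delta> - mdist m x x')"
    by (rule length_space_intermediate_point[OF m x(2) yM(1), of \<epsilon> "\<delta> - mdist m x x'"])
      (use False d \<open>\<epsilon> > 0\<close> in auto)
  have "mdist m x' y \<le> mdist m x x' + mdist m x y"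
    using mdist_triangle[OF x(2,1) yM(1)] mdist_commute[of m x x'] by simp
  then have "mdist m y p < \<delta>" using p(3) yM(2) mdist_commute[of m p y] by linarith
  then show ?thesis using p x by (auto simp: adjacency_edges_def)
qed

text \<open>Induction on the distance in units of \<open>\<epsilon> / 2\<close>. The last edge
  spends one half of \<open>\<epsilon>\<close> on progress towards \<open>x\<close> and the other on
  the slack of the near-geodesic.\<close>

lemma adjacency_connected:
  assumes m: "compact_length_space m" and \<epsilon>: "\<epsilon> > 0" and xy: "x \<in> mspace m" "y \<in> mspace m"
  shows "(x, y) \<in> (adjacency_edges m \<epsilon>)\<^sup>*"
proof -
  have "(x, y) \<in> (adjacency_edges m \<epsilon>)\<^sup>*"
    if "y \<in> mspace m" "mdist m x y \<le> real k * (\<epsilon> / 2)" for k y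
    using that
  proof (induction k arbitrary: y)
    case 0
    then have "x = y" using xy(1) mdist_nonneg[of m x y] mdist_zero[of x m y] by simp
    then show ?case by simp
  next
    case (Suc k)
    show ?case
    proof (cases "mdist m x y \<le> \<epsilon> / 2")
      case True
      then show ?thesis using Suc xy \<epsilon> by (intro r_into_rtrancl) (auto simp: adjacency_edges_def)
    next
      case False
      obtain p where p: "p \<in> mspace m" "mdist m x p = mdist m x y - \<epsilon> / 2"
          "mdist m p y < mdist m x y - (mdist m x y - \<epsilon> / 2) + \<epsilon> / 2"
        by (rule length_space_intermediate_point[OF m xy(1) Suc.prems(1), of "mdist m x y - \<epsilon> / 2" "\<epsilon> / 2"])
          (use False \<epsilon> in auto)
      have "(x, p) \<in> (adjacency_edges m \<epsilon>)\<^sup>*"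
        by (rule Suc.IH[OF p(1)]) (use p(2) Suc.prems(2) in \<open>simp add: algebra_simps\<close>)
      moreover have "(p, y) \<in> adjacency_edges m \<epsilon>"
        using p Suc.prems(1) by (simp add: adjacency_edges_def)
      ultimately show ?thesis by (rule rtrancl_into_rtrancl)
    qed
  qed
  moreover obtain k where "mdist m x y < real k * (\<epsilon> / 2)"
    using reals_Archimedean3[of "\<epsilon> / 2"] \<epsilon> by auto
  ultimately show ?thesis using xy(2) by (meson less_imp_le)
qed

section \<open>The two classes of graphs\<close>

lemma solvable_iff_adjacency:
  assumes adj: "is_adjacency_graph m \<epsilon> V E" and f: "continuous_map (mtopology_of m) euclideanreal f"
    and graph: "undirected_graph V E"
  shows "(\<exists>u. is_solution V E f u) \<longleftrightarrow> long_term_advantage V E f = 0"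
proof -
  have m: "compact_length_space m" and \<epsilon>: "\<epsilon> > 0" and V: "V = mspace m"
    and E: "E = adjacency_edges m \<epsilon>"
    using adj by (auto simp: is_adjacency_graph_def)
  interpret Metric_space V "mdist m" unfolding V by (rule Metric_space_mspace_mdist)
  have top: "mtopology_of m = mtopology" by (simp add: mtopology_of_def V)
  have cpt: "compact_space mtopology" using m unfolding compact_length_space_def top by simp
  have nbr: "E `` {x} = mcball x \<epsilon>" if "x \<in> V" for x
    using that by (auto simp: E adjacency_edges_def simp flip: V)
  have f_uc: "\<exists>\<delta>>0. \<forall>x\<in>V. \<forall>y\<in>V. mdist m x y < \<delta> \<longrightarrow> \<bar>f y - f x\<bar> < \<eta>" if "\<eta> > 0" for \<eta>
  proof -
    have "uniformly_continuous_map m euclidean_metric f"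
      using f cpt by (intro continuous_imp_uniformly_continuous_map) (simp add: top)
    then obtain \<delta> where "\<delta> > 0" "\<forall>x\<in>V. \<forall>y\<in>V. mdist m y x < \<delta> \<longrightarrow> dist (f y) (f x) < \<eta>"
      using \<open>\<eta> > 0\<close> unfolding uniformly_continuous_map_def V by auto
    then show ?thesis by (intro exI[of _ \<delta>]) (simp add: dist_real_def mdist_commute)
  qed
  interpret compact_payoff_graph V E f "mdist m"
  proof unfold_locales
    show "undirected_graph V E" by (rule graph)
    have "compactin euclideanreal (f ` topspace mtopology)"
      using f cpt unfolding top compact_space_def by (intro image_compactin)
    then show "bounded (f ` V)" by (simp add: compact_imp_bounded)
    show "closedin mtopology (E `` {x})" if "x \<in> V" for x using nbr[OF that] by simp
    show "\<exists>y'. (x', y') \<in> E \<and> mdist m y y' < \<delta>"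
      if "x \<in> V" "x' \<in> V" "(x, y) \<in> E" "mdist m x x' < \<delta>" for x x' y \<delta>
      using adjacency_transfer[OF m \<epsilon>] that by (simp add: V E)
    show "\<exists>\<delta>>0. \<forall>x'\<in>V. mdist m x x' < \<delta> \<longrightarrow> \<bar>f x' - f x\<bar> < \<eta>" if "x \<in> V" "\<eta> > 0" for x \<eta>
      using f_uc[OF that(2)] that(1) by blast
  qed (rule cpt)
  \<comment> \<open>The centres of finitely many balls of radius \<open>\<epsilon>\<close> form the
    net: each point of such a ball is adjacent to its centre.\<close>
  have "mtotally_bounded V"
    using cpt compactin_imp_mtotally_bounded by (simp add: compact_space_def)
  then obtain C where C: "finite C" "C \<subseteq> V" "V \<subseteq> (\<Union>c\<in>C. mball c \<epsilon>)"
    using \<epsilon> unfolding mtotally_bounded_def by meson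
  have cover: "V \<subseteq> C \<union> E `` C"
  proof
    fix x assume "x \<in> V"
    then obtain c where "c \<in> C" "mdist m c x < \<epsilon>" using C(3) by auto
    then show "x \<in> C \<union> E `` C" using C(2) \<open>x \<in> V\<close> unfolding E V adjacency_edges_def by fastforce
  qed
  have "compact (u ` (E `` {x}))"
    if u: "bounded (u ` V)" "\<And>x. x \<in> V \<Longrightarrow> tug_step E f u x = u x" and x: "x \<in> V" for u x
  proof -
    have f': "\<exists>\<delta>>0. \<forall>x\<in>V. \<forall>y\<in>V. mdist m x y < \<delta> \<longrightarrow> f x - f y < \<eta>" if "\<eta> > 0" for \<eta>
      using f_uc[OF that] by (smt (verit))
    have near: "(x, y) \<in> E" if "x \<in> V" "y \<in> V" "mdist m x y < \<epsilon>" for x y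
      using that by (simp add: E V adjacency_edges_def)
    have "uniformly_continuous_map m euclidean_metric u"
      unfolding uniformly_continuous_map_def
    proof (intro conjI allI impI)
      fix \<eta> :: real assume "\<eta> > 0"
      then obtain \<delta> where \<delta>: "\<delta> > 0" "\<And>x y. x \<in> V \<Longrightarrow> y \<in> V \<Longrightarrow> mdist m x y < \<delta> \<Longrightarrow> u x - u y < \<eta>"
        using fixed_point_uniformly_continuous[OF u \<epsilon> near f'] by blast
      have "\<bar>u y - u x\<bar> < \<eta>" if "x \<in> V" "y \<in> V" "mdist m y x < \<delta>" for x y
        using \<delta>(2)[of x y] \<delta>(2)[of y x] that mdist_commute[of m x y] by (simp add: abs_less_iff)
      then show "\<exists>\<delta>>0. \<forall>x\<in>mspace m. \<forall>y\<in>mspace m. mdist m y x < \<delta> \<longrightarrow>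
          mdist euclidean_metric (u y) (u x) < \<eta>"
        using \<delta>(1) by (intro exI[of _ \<delta>]) (auto simp: dist_real_def V)
    qed simp
    then have "continuous_map mtopology euclideanreal u"
      using uniformly_continuous_imp_continuous_map[of m euclidean_metric u] by (simp add: top)
    then have "compactin euclideanreal (u ` (E `` {x}))"
      using compactin_nbr[OF x] by (rule image_compactin[rotated])
    then show ?thesis by simp
  qed
  then show ?thesis
    using solvable_iff[OF _ C(1,2) cover] adjacency_connected[OF m \<epsilon>] unfolding E V by blast
qed

lemma solvable_iff_finite:
  assumes fin: "finite V" and conn: "connected_graph V E"
  shows "(\<exists>u. is_solution V E f u) \<longleftrightarrow> long_term_advantage V E f = 0"
proof -
  interpret discrete_metric V .
  have graph: "undirected_graph V E" and reach: "\<And>x y. x \<in> V \<Longrightarrow> y \<in> V \<Longrightarrow> (x, y) \<in> E\<^sup>*"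
    using conn by (auto simp: connected_graph_def)
  have sub: "E `` {x} \<subseteq> V" for x using graph by (auto simp: undirected_graph_def)
  interpret compact_payoff_graph V E f dd
  proof unfold_locales
    show "compact_space disc.mtopology"
      using fin by (simp add: mtopology_discrete_metric compact_space_discrete_topology)
    show "closedin disc.mtopology (E `` {x})" for x
      using sub by (simp add: mtopology_discrete_metric closedin_discrete_topology)
    show "\<exists>y'. (x', y') \<in> E \<and> dd y y' < \<delta>"
      if x: "x' \<in> V" and y: "(x, y) \<in> E" and d: "dd x x' < \<delta>" for x x' y \<delta>
    proof (cases "x = x'")
      case True
      then show ?thesis using y d by (intro exI[of _ y]) (simp add: dd_def)
    next
      \<comment> \<open>Distinct centres have distance 1, so \<open>\<delta> > 1\<close> and any
        neighbour of \<open>x'\<close> is close enough.\<close>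
      case False
      obtain y' where "(x', y') \<in> E" using graph x by (auto simp: undirected_graph_def)
      then show ?thesis using dd_le1[of y y'] d False by (intro exI[of _ y']) (auto simp: dd_def)
    qed
    show "\<exists>\<delta>>0. \<forall>x'\<in>V. dd x x' < \<delta> \<longrightarrow> \<bar>f x' - f x\<bar> < \<eta>" if "\<eta> > 0" for x \<eta>
      using that by (intro exI[of _ 1]) (auto simp: dd_def)
  qed (use fin graph in \<open>auto intro: finite_imp_bounded\<close>)
  show ?thesis
    by (rule solvable_iff[OF reach fin])
      (use fin sub in \<open>auto intro!: finite_imp_compact finite_imageI intro: finite_subset\<close>)
qed

theorem theorem1p8:
  fixes V :: "'a set" and E :: "'a rel" and f :: "'a \<Rightarrow> real"
  assumes "undirected_graph V E"
    and "(\<exists>m \<epsilon>. is_adjacency_graph m \<epsilon> V E \<and> continuous_map (mtopology_of m) euclideanreal f) \<or>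
         (finite V \<and> connected_graph V E)"
  shows "(\<exists>u :: 'a \<Rightarrow> real. is_solution V E f u) \<longleftrightarrow> long_term_advantage V E f = 0"
  using assms solvable_iff_adjacency solvable_iff_finite by metis

end
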